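(* Let $B_1$ and $B_2$ be two bouquets. If $B_1$ and $B_2$ have the same signed intersection graph (i.e. $SI(B_1)$ and $SI(B_2)$ are isomorphic as vertex-signed graphs), then their partial-dual Euler genus polynomials coincide: ${}^{\partial}\varepsilon_{B_1}(z)={}^{\partial}\varepsilon_{B_2}(z)$.
   Context: Ribbon graphs are finite, possibly non-orientable. For a ribbon graph $G$, let $v(G),e(G),f(G)$ be its numbers of vertices, edges and boundary components. For connected $G$ the Euler genus $\varepsilon(G)$ is defined by $2-\varepsilon(G)=v(G)-e(G)+f(G)$. For $A\subseteq E(G)$ the partial dual $G^{A}$ is obtained as follows: take the spanning ribbon subgraph $(V(G),A)$, glue a disc to $G$ along each boundary component of this subgraph (these discs are the vertex-discs of $G^A$), and remove the interiors of all vertex-discs of $G$; the edge-ribbons are kept as the edges of $G^A$. The partial-dual Euler genus polynomial of $G$ is ${}^{\partial}\varepsilon_{G}(z)=\sum_{A\subseteq E(G)}z^{\varepsilon(G^{A})}$. A bouquet is a ribbon graph with exactly one vertex. A loop $e$ at the vertex-disc $v$ is twisted if $e\cup v$ is homeomorphic to a Möbius band, and untwisted otherwise. The intersection graph $I(B)$ of a bouquet $B$ is the graph with vertex set $E(B)$ in which distinct $e$ and $f$ are adjacent if and only if their ends are met in the cyclic order $e\cdots f\cdots e\cdots f\cdots$ when travelling around the boundary of the unique vertex of $B$. The signed intersection graph $SI(B)$ is $I(B)$ together with a sign at each vertex: $+$ if the corresponding edge of $B$ is an untwisted loop, $-$ if it is a twisted loop. *)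

theory Defs
  imports "HOL-Computational_Algebra.Polynomial"
begin

text \<open>
  Each edge-ribbon is a rectangle; its four corners are the points at which the boundary of
  the ribbon switches between the two \<^emph>\<open>ends\<close> (the arcs glued to vertex-discs) and the two
  \<^emph>\<open>sides\<close> (the free arcs).  Every corner lies on exactly one end, on exactly one side, and on
  exactly one arc of the boundary of a vertex-disc between two consecutive ends.  The three maps
  below send a corner to the other endpoint of the respective arc; together they determine the
  ribbon graph up to vertex-discs carrying no ribbon, which are only counted.  No orientation is
  involved, so non-orientable ribbon graphs are included.
\<close>

record 'c ribbon_graph =
  corners :: "'c set"
  end_arc :: "'c \<Rightarrow> 'c"
  side_arc :: "'c \<Rightarrow> 'c"
  vertex_arc :: "'c \<Rightarrow> 'c"
  isolated :: nat

definition matching_on :: "'c set \<Rightarrow> ('c \<Rightarrow> 'c) \<Rightarrow> bool" where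
  "matching_on S f \<longleftrightarrow> (\<forall>x\<in>S. f x \<in> S \<and> f x \<noteq> x \<and> f (f x) = x)"

text \<open>The last conjunct says that every ribbon is a rectangle with four distinct corners.\<close>

definition ribbon_graph :: "'c ribbon_graph \<Rightarrow> bool" where
  "ribbon_graph G \<longleftrightarrow>
     finite (corners G) \<and>
     matching_on (corners G) (end_arc G) \<and>
     matching_on (corners G) (side_arc G) \<and>
     matching_on (corners G) (vertex_arc G) \<and>
     (\<forall>x\<in>corners G. end_arc G (side_arc G x) = side_arc G (end_arc G x) \<and>
                     end_arc G x \<noteq> side_arc G x)"

text \<open>The closed curves formed by two families of arcs, each given as its set of corners.\<close>

definition curves :: "'c set \<Rightarrow> ('c \<Rightarrow> 'c) \<Rightarrow> ('c \<Rightarrow> 'c) \<Rightarrow> 'c set set" where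
  "curves S f g = (\<lambda>x. {(y, z). y \<in> S \<and> (z = f y \<or> z = g y)}\<^sup>* `` {x}) ` S"

definition edges :: "'c ribbon_graph \<Rightarrow> 'c set set" where
  "edges G = curves (corners G) (end_arc G) (side_arc G)"

definition num_vertices :: "'c ribbon_graph \<Rightarrow> nat" where
  "num_vertices G = card (curves (corners G) (end_arc G) (vertex_arc G)) + isolated G"

definition num_edges :: "'c ribbon_graph \<Rightarrow> nat" where
  "num_edges G = card (edges G)"

definition num_boundary :: "'c ribbon_graph \<Rightarrow> nat" where
  "num_boundary G = card (curves (corners G) (side_arc G) (vertex_arc G)) + isolated G"

text \<open>Meaningful for connected ribbon graphs only; for these it is nonnegative.\<close>

definition euler_genus :: "'c ribbon_graph \<Rightarrow> int" where
  "euler_genus G = 2 - (int (num_vertices G) - int (num_edges G) + int (num_boundary G))"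

text \<open>
  A boundary component of the spanning ribbon subgraph \<open>(V(G), A)\<close> runs along the arcs of the
  vertex-discs between consecutive ends, along the sides of the ribbons in \<open>A\<close>, and along the ends
  of the ribbons not in \<open>A\<close>, where it stays on the vertex-disc.  In \<open>G\<^sup>A\<close> these curves bound the
  vertex-discs.  Hence a ribbon in \<open>A\<close> is now attached along its former sides and its former ends
  become free, while the other ribbons are attached as before.  An isolated vertex-disc is
  replaced by the disc glued along its boundary.
\<close>

definition partial_dual :: "'c ribbon_graph \<Rightarrow> 'c set set \<Rightarrow> 'c ribbon_graph" where
  "partial_dual G A = G\<lparr>
     end_arc := (\<lambda>x. if x \<in> \<Union>A then side_arc G x else end_arc G x),
     side_arc := (\<lambda>x. if x \<in> \<Union>A then end_arc G x else side_arc G x)\<rparr>"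

text \<open>
  Partial duals of a connected ribbon graph are connected, so for connected \<open>G\<close>
  the conversion \<open>nat\<close> never truncates.
\<close>

definition partial_dual_genus_poly :: "'c ribbon_graph \<Rightarrow> int poly" where
  "partial_dual_genus_poly G =
     (\<Sum>A\<in>Pow (edges G). monom 1 (nat (euler_genus (partial_dual G A))))"

definition bouquet :: "'c ribbon_graph \<Rightarrow> bool" where
  "bouquet G \<longleftrightarrow> ribbon_graph G \<and> num_vertices G = 1"

text \<open>
  Orientability of the surface formed by the vertex-discs and the ribbon \<open>e\<close>.
  An orientation of a vertex-disc is a direction of travel around its boundary, recorded by
  marking, for each end, the corner that is met first; so the marking alternates along the boundary.
  It extends over \<open>e\<close> iff it also alternates along the sides of \<open>e\<close>.  In a bouquet
  the surface is a disc with one ribbon attached, i.e. an annulus or a Moebius band, and it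
  is a Moebius band iff it is not orientable.
\<close>

definition orientable_with :: "'c ribbon_graph \<Rightarrow> 'c set \<Rightarrow> bool" where
  "orientable_with G e \<longleftrightarrow> (\<exists>first :: 'c \<Rightarrow> bool.
     (\<forall>x\<in>corners G. first (end_arc G x) \<noteq> first x \<and> first (vertex_arc G x) \<noteq> first x) \<and>
     (\<forall>x\<in>e. first (side_arc G x) \<noteq> first x))"

definition twisted :: "'c ribbon_graph \<Rightarrow> 'c set \<Rightarrow> bool" where
  "twisted B e \<longleftrightarrow> \<not> orientable_with B e"

text \<open>
  Travelling around a vertex-disc: from the corner at which one end is entered to the
  corner at which the next end is entered.
\<close>

definition next_end :: "'c ribbon_graph \<Rightarrow> 'c \<Rightarrow> 'c" where
  "next_end G x = vertex_arc G (end_arc G x)"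

text \<open>The last conjunct confines the four ends to a single tour around the vertex-disc.\<close>

definition interlaced :: "'c ribbon_graph \<Rightarrow> 'c set \<Rightarrow> 'c set \<Rightarrow> bool" where
  "interlaced B e f \<longleftrightarrow> (\<exists>x\<in>e. \<exists>i j k. 0 < i \<and> i < j \<and> j < k \<and>
     (next_end B ^^ i) x \<in> f \<and> (next_end B ^^ j) x \<in> e \<and> (next_end B ^^ k) x \<in> f \<and>
     (\<forall>m. 0 < m \<and> m \<le> k \<longrightarrow> (next_end B ^^ m) x \<noteq> x))"

datatype sign = Plus | Minus

record 'v signed_graph =
  nodes :: "'v set"
  links :: "'v set set"
  sign_of :: "'v \<Rightarrow> sign"

definition signed_graph_iso :: "'v signed_graph \<Rightarrow> 'w signed_graph \<Rightarrow> bool" where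
  "signed_graph_iso H K \<longleftrightarrow> (\<exists>\<phi>. bij_betw \<phi> (nodes H) (nodes K) \<and>
     (\<forall>u\<in>nodes H. \<forall>v\<in>nodes H. {u, v} \<in> links H \<longleftrightarrow> {\<phi> u, \<phi> v} \<in> links K) \<and>
     (\<forall>u\<in>nodes H. sign_of K (\<phi> u) = sign_of H u))"

definition signed_intersection_graph :: "'c ribbon_graph \<Rightarrow> 'c set signed_graph" where
  "signed_intersection_graph B = \<lparr>
     nodes = edges B,
     links = {{e, f} | e f. e \<in> edges B \<and> f \<in> edges B \<and> e \<noteq> f \<and> interlaced B e f},
     sign_of = (\<lambda>e. if twisted B e then Minus else Plus)\<rparr>"

end

theory Submission
  imports Defs
begin

text \<open>
  The vertices of \<open>B\<^sup>A\<close> are the boundary components of the subbouquet with edge set \<open>A\<close>, and the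
  boundary components of \<open>B\<^sup>A\<close> are the vertices of the partial dual at the complement of \<open>A\<close>.
  So it suffices to recover the number \<open>f(A)\<close> of boundary components of each subbouquet from the
  signed intersection graph.  There are \<open>2^f(A)\<close> mod 2 functions on the corners that are
  constant on these components.  Such a function is determined up to complement by
  the set \<open>X\<close> of edges in \<open>A\<close> at whose ends it jumps.  Conversely, each \<open>X\<close> comes from a function
  on the boundary of the vertex-disc, and this function takes equal values along the sides of
  \<open>e \<in> A\<close> iff the number of edges in \<open>X\<close> interlaced with \<open>e\<close>, plus one if \<open>e\<close> is a twisted
  loop in \<open>X\<close>, is even.  Hence \<open>2^f(A)\<close> is twice the number of sets \<open>X\<close> with this parity
  property for all \<open>e \<in> A\<close>, which depends on the signed intersection graph only.
\<close>

section \<open>Matchings and ribbons\<close>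

lemma matching_onD:
  assumes "matching_on S f" and "x \<in> S"
  shows "f x \<in> S" and "f x \<noteq> x" and "f (f x) = x"
  using assms by (auto simp: matching_on_def)

section \<open>Counting closed curves by the mod 2 functions constant on them\<close>

definition invariant_sets :: "'c set \<Rightarrow> ('c \<Rightarrow> 'c) \<Rightarrow> ('c \<Rightarrow> 'c) \<Rightarrow> 'c set set" where
  "invariant_sets S f g = {U. U \<subseteq> S \<and> (\<forall>x\<in>S. (f x \<in> U \<longleftrightarrow> x \<in> U) \<and> (g x \<in> U \<longleftrightarrow> x \<in> U))}"

text \<open>Both maps are involutions on \<open>S\<close>, so reachability along the arcs is an
  equivalence relation whose classes are the curves. The invariant sets are therefore the unions of
  curves, and a family of curves can be read off from its union.\<close>

lemma card_invariant_sets: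
  assumes f: "matching_on S f" and g: "matching_on S g" and fin: "finite S"
  shows "card (invariant_sets S f g) = 2 ^ card (curves S f g)"
proof -
  define R where "R = {(y, z). y \<in> S \<and> (z = f y \<or> z = g y)}"
  define K where "K = (\<lambda>x. R\<^sup>* `` {x})"
  have curves: "curves S f g = K ` S"
    by (simp add: curves_def K_def R_def)
  have "sym R"
    using matching_onD[OF f] matching_onD[OF g] by (fastforce simp: sym_def R_def)
  then have sym: "sym (R\<^sup>*)"
    by (rule sym_rtrancl)
  have K_eq: "K y = K x" if "y \<in> K x" for x y
    using that sym unfolding K_def by (auto dest: symD intro: rtrancl_trans)
  have K_least: "K x \<subseteq> U" if U: "U \<in> invariant_sets S f g" and x: "x \<in> U" for U x
  proof
    fix y assume "y \<in> K x"
    then have "(x, y) \<in> R\<^sup>*" by (simp add: K_def)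
    then show "y \<in> U"
      by induction (use U x in \<open>auto simp: R_def invariant_sets_def\<close>)
  qed
  have self: "x \<in> K x" for x
    by (simp add: K_def)
  have "S \<in> invariant_sets S f g"
    using matching_onD[OF f] matching_onD[OF g] by (auto simp: invariant_sets_def)
  then have K_sub: "K x \<subseteq> S" if "x \<in> S" for x
    using K_least that by blast
  have step: "f y \<in> K x" "g y \<in> K x" if "y \<in> K x" "y \<in> S" for x y
    using that unfolding K_def R_def by (auto intro: rtrancl_into_rtrancl)
  have Un: "\<Union>F \<in> invariant_sets S f g" if "F \<subseteq> K ` S" for F
  proof -
    have "h y \<in> \<Union>F \<longleftrightarrow> y \<in> \<Union>F" if "h = f \<or> h = g" "y \<in> S" for h y
    proof -
      have "h y \<in> S" "h (h y) = y"
        using that matching_onD[OF f] matching_onD[OF g] by auto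
      moreover have "h z \<in> C" if "z \<in> C" "C \<in> F" "z \<in> S" for z C
        using step \<open>F \<subseteq> K ` S\<close> that \<open>h = f \<or> h = g\<close> by blast
      ultimately show ?thesis
        using that by (metis Union_iff)
    qed
    then show ?thesis
      using that K_sub unfolding invariant_sets_def by blast
  qed
  have "bij_betw Union (Pow (K ` S)) (invariant_sets S f g)"
  \<comment> \<open>The inverse of taking unions collects the curves that lie inside a given
    set.\<close>
  proof (rule bij_betw_byWitness[where f' = "\<lambda>U. {C \<in> K ` S. C \<subseteq> U}"])
    show "\<forall>F\<in>Pow (K ` S). {C \<in> K ` S. C \<subseteq> \<Union>F} = F"
    proof
      fix F assume F: "F \<in> Pow (K ` S)"
      have "C \<in> F" if C: "C \<in> K ` S" "C \<subseteq> \<Union>F" for C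
      proof -
        obtain x where x: "C = K x" using C by blast
        then obtain C' where C': "C' \<in> F" "x \<in> C'" using C self by blast
        then obtain y where y: "C' = K y" using F by blast
        then have "K x = K y" using C'(2) K_eq[of x y] by simp
        then show ?thesis using C'(1) x y by simp
      qed
      then show "{C \<in> K ` S. C \<subseteq> \<Union>F} = F" using F by blast
    qed
    show "\<forall>U\<in>invariant_sets S f g. \<Union>{C \<in> K ` S. C \<subseteq> U} = U"
    proof
      fix U assume U: "U \<in> invariant_sets S f g"
      have "x \<in> \<Union>{C \<in> K ` S. C \<subseteq> U}" if "x \<in> U" for x
      proof
        show "K x \<in> {C \<in> K ` S. C \<subseteq> U}"
          using U that K_least by (auto simp: invariant_sets_def)
      qed (rule self)
      then show "\<Union>{C \<in> K ` S. C \<subseteq> U} = U" by auto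
    qed
    show "Union ` Pow (K ` S) \<subseteq> invariant_sets S f g"
      using Un by blast
  qed auto
  then have "card (invariant_sets S f g) = card (Pow (K ` S))"
    by (simp add: bij_betw_same_card)
  then show ?thesis
    using fin by (simp add: curves card_Pow)
qed

lemma ribbon_graphD:
  assumes "ribbon_graph G"
  shows "finite (corners G)" and "matching_on (corners G) (end_arc G)"
    and "matching_on (corners G) (side_arc G)" and "matching_on (corners G) (vertex_arc G)"
    and "x \<in> corners G \<Longrightarrow> end_arc G (side_arc G x) = side_arc G (end_arc G x)"
    and "x \<in> corners G \<Longrightarrow> end_arc G x \<noteq> side_arc G x"
  using assms by (auto simp: ribbon_graph_def)

section \<open>Edges as ribbons with four corners\<close>

definition ribbon :: "'c ribbon_graph \<Rightarrow> 'c \<Rightarrow> 'c set" where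
  "ribbon G x = {x, end_arc G x, side_arc G x, end_arc G (side_arc G x)}"

text \<open>End and side arcs commute, so a walk along them from a corner never leaves the four
  corners listed in \<open>ribbon\<close>.\<close>

lemma edges_eq_ribbons:
  assumes G: "ribbon_graph G"
  shows "edges G = ribbon G ` corners G"
proof -
  note E = matching_onD[OF ribbon_graphD(2)[OF G]]
  note D = matching_onD[OF ribbon_graphD(3)[OF G]]
  note ED = ribbon_graphD(5)[OF G]
  define R where "R = {(y, z). y \<in> corners G \<and> (z = end_arc G y \<or> z = side_arc G y)}"
  have "R\<^sup>* `` {x} = ribbon G x" if x: "x \<in> corners G" for x
  proof
    show "R\<^sup>* `` {x} \<subseteq> ribbon G x"
    proof
      fix y assume "y \<in> R\<^sup>* `` {x}"
      then have "(x, y) \<in> R\<^sup>*" by simp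
      then show "y \<in> ribbon G x"
        by induction (use x E D ED in \<open>auto simp: R_def ribbon_def\<close>)
    qed
    have "(x, end_arc G x) \<in> R" "(x, side_arc G x) \<in> R"
      "(side_arc G x, end_arc G (side_arc G x)) \<in> R"
      using x D by (auto simp: R_def)
    then show "ribbon G x \<subseteq> R\<^sup>* `` {x}"
      unfolding ribbon_def by (auto intro: rtrancl_into_rtrancl)
  qed
  then show ?thesis
    unfolding edges_def curves_def R_def by (auto intro!: image_cong)
qed

lemma edge_eq_ribbon:
  assumes G: "ribbon_graph G" and "e \<in> edges G" and "z \<in> e"
  shows "e = ribbon G z" and "z \<in> corners G"
proof -
  note E = matching_onD[OF ribbon_graphD(2)[OF G]]
  note D = matching_onD[OF ribbon_graphD(3)[OF G]]
  note ED = ribbon_graphD(5)[OF G]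
  obtain x where x: "x \<in> corners G" "e = ribbon G x"
    using assms edges_eq_ribbons[OF G] by auto
  show "z \<in> corners G"
    using x assms(3) E D by (auto simp: ribbon_def)
  show "e = ribbon G z"
    using x assms(3) E D ED by (auto simp: ribbon_def)
qed

lemma ribbon_in_edges: "ribbon_graph G \<Longrightarrow> x \<in> corners G \<Longrightarrow> ribbon G x \<in> edges G"
  by (simp add: edges_eq_ribbons)

lemma self_in_ribbon: "x \<in> ribbon G x"
  by (simp add: ribbon_def)

section \<open>Sets of edges and partial duals\<close>

lemma Union_edges_arcs:
  assumes G: "ribbon_graph G" and A: "A \<subseteq> edges G" and x: "x \<in> corners G"
  shows "end_arc G x \<in> \<Union>A \<longleftrightarrow> x \<in> \<Union>A" and "side_arc G x \<in> \<Union>A \<longleftrightarrow> x \<in> \<Union>A"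
proof -
  note E = matching_onD[OF ribbon_graphD(2)[OF G]]
  note D = matching_onD[OF ribbon_graphD(3)[OF G]]
  have *: "end_arc G z \<in> \<Union>A \<and> side_arc G z \<in> \<Union>A" if z: "z \<in> \<Union>A" for z
  proof -
    obtain e where e: "e \<in> A" "z \<in> e" using z by blast
    then have "e = ribbon G z" using edge_eq_ribbon(1)[OF G] A by blast
    then have "end_arc G z \<in> e" "side_arc G z \<in> e" by (auto simp: ribbon_def)
    then show ?thesis using e(1) by blast
  qed
  show "end_arc G x \<in> \<Union>A \<longleftrightarrow> x \<in> \<Union>A"
    using *[of x] *[of "end_arc G x"] E x by auto
  show "side_arc G x \<in> \<Union>A \<longleftrightarrow> x \<in> \<Union>A"
    using *[of x] *[of "side_arc G x"] D x by auto
qed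

lemma finite_edges: "ribbon_graph G \<Longrightarrow> finite (edges G)"
  by (simp add: edges_eq_ribbons ribbon_graphD)

text \<open>Arcs are swapped ribbon by ribbon, so both corners of a new end arc follow the same rule
  and the arc map remains an involution.\<close>

lemma matching_on_partial_dual:
  assumes G: "ribbon_graph G" and A: "A \<subseteq> edges G"
  shows "matching_on (corners G) (end_arc (partial_dual G A))"
  unfolding matching_on_def
proof
  fix x assume x: "x \<in> corners G"
  show "end_arc (partial_dual G A) x \<in> corners G \<and> end_arc (partial_dual G A) x \<noteq> x \<and>
    end_arc (partial_dual G A) (end_arc (partial_dual G A) x) = x"
    using Union_edges_arcs[OF G A x] matching_onD[OF ribbon_graphD(2)[OF G] x]
      matching_onD[OF ribbon_graphD(3)[OF G] x]
    by (cases "x \<in> \<Union>A") (auto simp: partial_dual_def)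
qed

lemma num_edges_partial_dual: "num_edges (partial_dual G A) = num_edges G"
proof -
  have "z = (if y \<in> \<Union>A then side_arc G y else end_arc G y) \<or>
      z = (if y \<in> \<Union>A then end_arc G y else side_arc G y) \<longleftrightarrow>
      z = end_arc G y \<or> z = side_arc G y" for y z
    by (cases "y \<in> \<Union>A") (simp_all only: if_True if_False disj_commute)
  then show ?thesis
    by (simp add: num_edges_def edges_def curves_def partial_dual_def del: Union_iff)
qed

text \<open>Every corner lies on exactly one edge, so the free sides in the dual at \<open>A\<close>
  are the attaching arcs in the dual at the complement.\<close>

lemma num_boundary_partial_dual:
  assumes G: "ribbon_graph G" and A: "A \<subseteq> edges G"
  shows "num_boundary (partial_dual G A) = num_vertices (partial_dual G (edges G - A))"
proof -
  have *: "x \<in> \<Union>(edges G - A) \<longleftrightarrow> x \<notin> \<Union>A" if "x \<in> corners G" for x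
  proof -
    have "ribbon G x \<in> edges G" by (rule ribbon_in_edges[OF G that])
    moreover have "e = ribbon G x" if "e \<in> edges G" "x \<in> e" for e
      using edge_eq_ribbon(1)[OF G] that by blast
    ultimately show ?thesis
      using A self_in_ribbon[of x G] by blast
  qed
  have "{(y, z). y \<in> corners G \<and> (z = (if y \<in> \<Union>A then end_arc G y else side_arc G y) \<or>
      z = vertex_arc G y)} =
    {(y, z). y \<in> corners G \<and> (z = (if y \<in> \<Union>(edges G - A) then side_arc G y else end_arc G y) \<or>
      z = vertex_arc G y)}"
    using * by auto
  then show ?thesis
    unfolding num_boundary_def num_vertices_def curves_def partial_dual_def by simp
qed

section \<open>Parity in signed graphs\<close>

text \<open>A twisted loop counts as crossing itself: a function that jumps at its two ends differs
  along its own sides.\<close>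

definition crosses :: "'v signed_graph \<Rightarrow> 'v \<Rightarrow> 'v \<Rightarrow> bool" where
  "crosses H u v \<longleftrightarrow> (if u = v then sign_of H u = Minus else {u, v} \<in> links H)"

text \<open>The kernel over GF(2) of the submatrix on \<open>A\<close> of the adjacency matrix of \<open>H\<close>, where
  a node of sign \<open>Minus\<close> has diagonal entry 1.\<close>

definition even_subsets :: "'v signed_graph \<Rightarrow> 'v set \<Rightarrow> 'v set set" where
  "even_subsets H A = {X. X \<subseteq> A \<and> (\<forall>u\<in>A. even (card {v \<in> X. crosses H u v}))}"

lemma card_even_subsets_image:
  assumes bij: "bij_betw \<phi> (nodes H) (nodes K)"
    and links: "\<And>u v. u \<in> nodes H \<Longrightarrow> v \<in> nodes H \<Longrightarrow> {u, v} \<in> links H \<longleftrightarrow> {\<phi> u, \<phi> v} \<in> links K"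
    and sign: "\<And>u. u \<in> nodes H \<Longrightarrow> sign_of K (\<phi> u) = sign_of H u"
    and A: "A \<subseteq> nodes H"
  shows "card (even_subsets K (\<phi> ` A)) = card (even_subsets H A)"
proof -
  have inj: "inj_on \<phi> (nodes H)" using bij by (simp add: bij_betw_def)
  have crosses: "crosses K (\<phi> u) (\<phi> v) \<longleftrightarrow> crosses H u v" if "u \<in> A" "v \<in> A" for u v
    using that A links sign inj_on_eq_iff[OF inj] unfolding crosses_def by (simp add: subset_iff)
  have "card {w \<in> \<phi> ` X. crosses K (\<phi> u) w} = card {v \<in> X. crosses H u v}"
    if u: "u \<in> A" and X: "X \<subseteq> A" for u X
  proof -
    have "{w \<in> \<phi> ` X. crosses K (\<phi> u) w} = \<phi> ` {v \<in> X. crosses H u v}"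
      using crosses[OF u] X by blast
    moreover have "inj_on \<phi> {v \<in> X. crosses H u v}"
      by (rule inj_on_subset[OF inj]) (use X A in auto)
    ultimately show ?thesis by (simp add: card_image)
  qed
  then have mem: "\<phi> ` X \<in> even_subsets K (\<phi> ` A) \<longleftrightarrow> X \<in> even_subsets H A" if "X \<subseteq> A" for X
    using that unfolding even_subsets_def by auto
  have "even_subsets K (\<phi> ` A) = image \<phi> ` even_subsets H A"
  proof
    show "even_subsets K (\<phi> ` A) \<subseteq> image \<phi> ` even_subsets H A"
    proof
      fix Y assume Y: "Y \<in> even_subsets K (\<phi> ` A)"
      then obtain X where "X \<subseteq> A" "Y = \<phi> ` X" by (auto simp: even_subsets_def subset_image_iff)
      then show "Y \<in> image \<phi> ` even_subsets H A" using mem Y by blast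
    qed
    show "image \<phi> ` even_subsets H A \<subseteq> even_subsets K (\<phi> ` A)"
      using mem by (auto simp: even_subsets_def)
  qed
  moreover have "inj_on (image \<phi>) (even_subsets H A)"
    by (rule inj_on_subset[OF inj_on_image_Pow[OF inj]]) (use A in \<open>auto simp: even_subsets_def\<close>)
  ultimately show ?thesis by (simp add: card_image)
qed

section \<open>The tour around the vertex-disc\<close>

text \<open>The edgeless bouquet is left out because its vertex is an isolated disc without a corner
  at which a tour could start.\<close>

locale nonempty_bouquet =
  fixes B :: "'c ribbon_graph"
  assumes bouquet: "bouquet B" and nonempty: "corners B \<noteq> {}"
begin

abbreviation "S \<equiv> corners B"
abbreviation "E \<equiv> end_arc B"
abbreviation "D \<equiv> side_arc B"
abbreviation "V \<equiv> vertex_arc B"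
abbreviation "n \<equiv> next_end B"

lemma ribbon_graph: "ribbon_graph B"
  using bouquet by (simp add: bouquet_def)

lemmas E_D = ribbon_graphD(5)[OF ribbon_graph]
lemmas E_ne_D = ribbon_graphD(6)[OF ribbon_graph]
lemmas E = matching_onD[OF ribbon_graphD(2)[OF ribbon_graph]]
lemmas D = matching_onD[OF ribbon_graphD(3)[OF ribbon_graph]]
lemmas V = matching_onD[OF ribbon_graphD(4)[OF ribbon_graph]]

lemma finite_corners: "finite S"
  by (rule ribbon_graphD(1)[OF ribbon_graph])

lemma isolated: "isolated B = 0" and card_curves: "card (curves S E V) = 1"
proof -
  have "card (curves S E V) > 0"
    using finite_corners nonempty by (auto simp: curves_def card_gt_0_iff)
  then show "isolated B = 0" "card (curves S E V) = 1"
    using bouquet by (auto simp: bouquet_def num_vertices_def)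
qed

text \<open>One vertex means one curve, hence exactly two invariant sets, and the two trivial ones
  already account for them.\<close>

lemma connected:
  assumes "U \<in> invariant_sets S E V"
  shows "U = {} \<or> U = S"
proof -
  have card: "card (invariant_sets S E V) = 2"
    using card_invariant_sets[of S E V] ribbon_graphD[OF ribbon_graph] card_curves by simp
  have "{{}, S} \<subseteq> invariant_sets S E V"
    using E V by (auto simp: invariant_sets_def)
  moreover have "card {{}, S} = 2"
    using nonempty by auto
  moreover have "finite (invariant_sets S E V)"
    by (rule card_ge_0_finite) (simp add: card)
  ultimately have "{{}, S} = invariant_sets S E V"
    using card card_subset_eq by metis
  then show ?thesis using assms by blast
qed

lemma next_in: "x \<in> S \<Longrightarrow> n x \<in> S"
  by (simp add: next_end_def E V)

lemma funpow_next_in: "x \<in> S \<Longrightarrow> (n ^^ m) x \<in> S"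
  by (induction m) (simp_all add: next_in)

lemma inj_next: "inj_on n S"
proof (rule inj_onI)
  fix x y assume *: "x \<in> S" "y \<in> S" "n x = n y"
  then have "E x = E y" using V E unfolding next_end_def by metis
  then show "x = y" using * E by metis
qed

lemma inj_funpow_next: "inj_on (n ^^ a) S"
proof (induction a)
  case (Suc a)
  show ?case
    using Suc inj_next funpow_next_in by (auto simp: inj_on_def)
qed simp

lemma funpow_next_cancel:
  assumes "x \<in> S" and "(n ^^ (a + b)) x = (n ^^ a) x"
  shows "(n ^^ b) x = x"
  using assms inj_funpow_next[of a] funpow_next_in[of x b] by (auto simp: funpow_add inj_on_def)

text \<open>Along a boundary walk the corners at which ends are entered never coincide with the corners
  at which they are left: otherwise, as \<open>E\<close> reverses the walk, one of the two matchings would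
  have a fixed point halfway.\<close>

lemma E_ne_funpow: "x \<in> S \<Longrightarrow> E x \<noteq> (n ^^ b) x"
proof (induction b arbitrary: x rule: induct_nat_012)
  case 0
  then show ?case by (simp add: E)
next
  case 1
  then show ?case using V(2)[OF E(1)[OF 1]] by (simp add: next_end_def)
next
  \<comment> \<open>An equality here yields the same equality for the walk shortened by one step at
    each end, hence the induction in steps of two.\<close>
  case (ge2 b)
  have y: "n x \<in> S" "(n ^^ b) (n x) \<in> S" using ge2 next_in funpow_next_in by auto
  show ?case
  proof
    assume "E x = (n ^^ Suc (Suc b)) x"
    also have "\<dots> = n ((n ^^ b) (n x))" by (simp add: funpow_swap1)
    also have "\<dots> = V (E ((n ^^ b) (n x)))" by (simp add: next_end_def)
    finally have "V (E x) = E ((n ^^ b) (n x))" using V(3) E(1) y by metis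
    then have "E (n x) = (n ^^ b) (n x)" using E(3)[OF y(2)] by (metis next_end_def)
    then show False using ge2.IH(1)[OF y(1)] by simp
  qed
qed

lemma E_funpow_ne: 
  assumes x: "x \<in> S"
  shows "E ((n ^^ a) x) \<noteq> (n ^^ b) x"
proof
  assume eq: "E ((n ^^ a) x) = (n ^^ b) x"
  show False
  proof (cases "a \<le> b")
    case True
    then have "(n ^^ b) x = (n ^^ (b - a)) ((n ^^ a) x)"
      by (metis comp_apply funpow_add le_add_diff_inverse2)
    then show False using eq E_ne_funpow[OF funpow_next_in[OF x]] by metis
  next
    case False
    then have "(n ^^ a) x = (n ^^ (a - b)) ((n ^^ b) x)"
      by (metis comp_apply funpow_add le_add_diff_inverse2 nat_le_linear)
    moreover have "E ((n ^^ b) x) = (n ^^ a) x"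
      using eq E(3)[OF funpow_next_in[OF x]] by metis
    ultimately show False using E_ne_funpow[OF funpow_next_in[OF x]] by metis
  qed
qed

text \<open>The number of ends on the vertex-disc, by \<open>tour_cases\<close> and
  \<open>E_funpow_ne\<close>.\<close>

definition period :: "'c \<Rightarrow> nat" where
  "period x = (LEAST N. 0 < N \<and> (n ^^ N) x = x)"

lemma period:
  assumes x: "x \<in> S"
  shows period_pos: "0 < period x" and funpow_period: "(n ^^ period x) x = x"
proof -
  \<comment> \<open>Finitely many corners force two iterates to agree; cancelling the smaller
    exponent gives a return to \<open>x\<close>.\<close>
  have "\<not> inj (\<lambda>m. (n ^^ m) x)"
  proof
    assume "inj (\<lambda>m. (n ^^ m) x)"
    then have "infinite (range (\<lambda>m. (n ^^ m) x))" by (rule range_inj_infinite)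
    moreover have "range (\<lambda>m. (n ^^ m) x) \<subseteq> S" using funpow_next_in x by blast
    ultimately show False using finite_corners finite_subset by blast
  qed
  then obtain a b where "a \<noteq> b" "(n ^^ a) x = (n ^^ b) x"
    by (auto simp: inj_def)
  then obtain a b where "a < b" "(n ^^ b) x = (n ^^ a) x"
    by (metis nat_neq_iff)
  then have "0 < b - a \<and> (n ^^ (b - a)) x = x"
    using funpow_next_cancel[OF x, of a "b - a"] by simp
  then have "0 < period x \<and> (n ^^ period x) x = x"
    unfolding period_def by (rule LeastI)
  then show "0 < period x" "(n ^^ period x) x = x" by auto
qed

lemma period_least: "0 < m \<Longrightarrow> m < period x \<Longrightarrow> (n ^^ m) x \<noteq> x"
  unfolding period_def using not_less_Least by blast

lemma funpow_eq_iff: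
  assumes x: "x \<in> S" and "a < period x" "b < period x"
  shows "(n ^^ a) x = (n ^^ b) x \<longleftrightarrow> a = b"
proof -
  have "False" if "a < b" "b < period x" "(n ^^ a) x = (n ^^ b) x" for a b
    using that funpow_next_cancel[OF x, of a "b - a"] period_least[of "b - a" x] by simp
  then show ?thesis using assms by (metis nat_neq_iff)
qed

lemma E_funpow_eq_iff:
  assumes x: "x \<in> S" and "a < period x" "b < period x"
  shows "E ((n ^^ a) x) = E ((n ^^ b) x) \<longleftrightarrow> a = b"
  using funpow_eq_iff[OF assms] E(3) funpow_next_in[OF x] by metis

lemma V_E_funpow: "V (E ((n ^^ m) x)) = (n ^^ Suc m) x"
  by (simp add: next_end_def)

lemma V_funpow_Suc: "x \<in> S \<Longrightarrow> V ((n ^^ Suc m) x) = E ((n ^^ m) x)"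
  using V(3)[OF E(1)[OF funpow_next_in[of x m]]] by (simp add: next_end_def)

lemma V_start: "x \<in> S \<Longrightarrow> V x = E ((n ^^ (period x - 1)) x)"
  using V_funpow_Suc[of x "period x - 1"] period[of x] by simp

text \<open>The corners entered or left during one tour form a nonempty set closed under
  \<open>E\<close> and \<open>V\<close>, so by \<open>connected\<close> they are all
  corners.\<close>

lemma tour_cases:
  assumes x: "x \<in> S" and z: "z \<in> S"
  obtains m where "m < period x" and "z = (n ^^ m) x"
  | m where "m < period x" and "z = E ((n ^^ m) x)"
proof -
  let ?P = "(\<lambda>m. (n ^^ m) x) ` {..<period x}"
  let ?U = "?P \<union> E ` ?P"
  note inS = funpow_next_in[OF x]
  have E_U: "E y \<in> ?U" if "y \<in> ?U" for y
    using that E(3) inS by auto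
  have V_U: "V y \<in> ?U" if y: "y \<in> ?U" for y
  proof -
    from y consider m where "m < period x" "y = (n ^^ m) x"
      | m where "m < period x" "y = E ((n ^^ m) x)" by auto
    then show ?thesis
    proof cases
      case 1
      show ?thesis
      proof (cases m)
        case 0
        then show ?thesis using 1 V_start[OF x] by auto
      next
        case (Suc k)
        then show ?thesis using 1 V_funpow_Suc[OF x, of k] by auto
      qed
    next
      case 2
      then have Vy: "V y = (n ^^ Suc m) x" using V_E_funpow by simp
      show ?thesis
      proof (cases "Suc m < period x")
        case True
        then show ?thesis unfolding Vy by blast
      next
        case False
        then have "Suc m = period x" using 2 by simp
        then have "V y = (n ^^ 0) x" using Vy funpow_period[OF x] by simp
        then show ?thesis using period_pos[OF x] by blast
      qed
    qed
  qed
  have "?U \<subseteq> S" using inS E(1) by auto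
  then have "?U \<in> invariant_sets S E V"
    using E_U V_U E(3) V(3) unfolding invariant_sets_def by (smt (verit) mem_Collect_eq)
  moreover have "x \<in> ?U" using period_pos[OF x] by (force intro!: image_eqI[of _ _ 0])
  ultimately have "?U = S" using connected by blast
  then show thesis using z that by auto
qed

lemma edge_eq: "e \<in> edges B \<Longrightarrow> z \<in> e \<Longrightarrow> e = {z, E z, D z, E (D z)}"
  using edge_eq_ribbon(1)[OF ribbon_graph] by (simp add: ribbon_def)

lemma edge_in: "e \<in> edges B \<Longrightarrow> z \<in> e \<Longrightarrow> z \<in> S"
  by (rule edge_eq_ribbon(2)[OF ribbon_graph])

lemma edge_arcs_in:
  assumes "e \<in> edges B" and "z \<in> S"
  shows "E z \<in> e \<longleftrightarrow> z \<in> e" and "D z \<in> e \<longleftrightarrow> z \<in> e"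
  using Union_edges_arcs[OF ribbon_graph, of "{e}" z] assms by auto

lemma edge_unique: "e \<in> edges B \<Longrightarrow> f \<in> edges B \<Longrightarrow> z \<in> e \<Longrightarrow> z \<in> f \<Longrightarrow> e = f"
  using edge_eq by blast

lemma edge_nonempty: "e \<in> edges B \<Longrightarrow> e \<noteq> {}"
  by (auto simp: edges_eq_ribbons[OF ribbon_graph] ribbon_def)

section \<open>Potentials\<close>

text \<open>A potential of \<open>T\<close> is a mod 2 function on the corners that is constant on the arcs
  of the vertex-disc between consecutive ends and jumps exactly at the ends with corners in \<open>T\<close>.\<close>

definition potential :: "'c set \<Rightarrow> 'c set \<Rightarrow> bool" where
  "potential T U \<longleftrightarrow> U \<subseteq> S \<and>
     (\<forall>z\<in>S. (V z \<in> U \<longleftrightarrow> z \<in> U) \<and> ((E z \<in> U \<longleftrightarrow> z \<in> U) \<longleftrightarrow> z \<notin> T))"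

text \<open>The obstruction to \<open>U\<close> being constant along the sides of a ribbon, as is
  required on the ribbons of \<open>A\<close>.\<close>

definition separates :: "'c set \<Rightarrow> 'c \<Rightarrow> bool" where
  "separates U z \<longleftrightarrow> (D z \<in> U \<longleftrightarrow> z \<notin> U)"

text \<open>Symmetric difference is addition of mod 2 functions, under which jumps add as
  well.\<close>

lemma potential_symdiff:
  assumes "potential T U" and "potential T' U'"
  shows "potential ((T - T') \<union> (T' - T)) ((U - U') \<union> (U' - U))"
  using assms unfolding potential_def by blast

lemma separates_symdiff:
  "separates ((U - U') \<union> (U' - U)) z \<longleftrightarrow> (separates U z \<longleftrightarrow> \<not> separates U' z)"
  unfolding separates_def by blast

lemma potential_compl: "potential T U \<Longrightarrow> potential T (S - U)"
  using E(1) V(1) unfolding potential_def by auto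

lemma separates_compl: "z \<in> S \<Longrightarrow> separates (S - U) z \<longleftrightarrow> separates U z"
  using D(1) unfolding separates_def by auto

text \<open>The sum of two potentials with the same jumps has no jump at all, so it is constant by
  \<open>connected\<close>.\<close>

lemma potential_unique:
  assumes "potential T U" and "potential T U'"
  shows "U' = U \<or> U' = S - U"
proof -
  have sub: "U \<subseteq> S" "U' \<subseteq> S" using assms by (auto simp: potential_def)
  have "potential {} ((U - U') \<union> (U' - U))"
    using potential_symdiff[OF assms] by simp
  then have "(U - U') \<union> (U' - U) \<in> invariant_sets S E V"
    unfolding potential_def invariant_sets_def by blast
  then have "(U - U') \<union> (U' - U) = {} \<or> (U - U') \<union> (U' - U) = S"
    by (rule connected)
  then show ?thesis using sub by blast
qed

text \<open>Hence separation can be computed with any convenient potential, such as the arcs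
  below.\<close>

lemma separates_unique:
  assumes "potential T U" and "potential T U'" and "z \<in> S"
  shows "separates U' z \<longleftrightarrow> separates U z"
  using potential_unique[OF assms(1,2)] separates_compl[OF assms(3)] by blast

text \<open>Both ends of a ribbon jump or neither does, since the jump set is a union of edges.
  Crossing the ends therefore changes both endpoints of a side alike.\<close>

lemma separates_edge:
  assumes U: "potential (\<Union>X) U" and X: "X \<subseteq> edges B" and e: "e \<in> edges B"
    and z: "z \<in> e" and w: "w \<in> e"
  shows "separates U w \<longleftrightarrow> separates U z"
proof -
  have zS: "z \<in> S" using edge_in e z by blast
  have T: "D x \<in> \<Union>X \<longleftrightarrow> x \<in> \<Union>X" if "x \<in> S" for x
    using Union_edges_arcs(2)[OF ribbon_graph X that] .
  have sep_E: "separates U (E x) \<longleftrightarrow> separates U x" if x: "x \<in> S" for x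
    using U T[OF x] x D(1)[OF x] E_D[OF x] unfolding potential_def separates_def by metis
  have sep_D: "separates U (D x) \<longleftrightarrow> separates U x" if x: "x \<in> S" for x
    using D(3)[OF x] unfolding separates_def by auto
  have "w \<in> {z, E z, D z, E (D z)}" using edge_eq[OF e z] w by simp
  then show ?thesis
    using sep_E sep_D zS D(1) by auto
qed

text \<open>The stretch of the vertex boundary from leaving the end at \<open>x\<close> to entering
  the end with index \<open>j\<close>. The end at \<open>x\<close> contributes only its left corner
  and the end at \<open>j\<close> only its entered corner.\<close>

definition arc :: "'c \<Rightarrow> nat \<Rightarrow> 'c set" where
  "arc x j = (\<lambda>m. E ((n ^^ m) x)) ` {..<j} \<union> (\<lambda>m. (n ^^ m) x) ` {0<..j}"

lemma arc_iff:
  assumes x: "x \<in> S" and "m < period x" and "j < period x"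
  shows funpow_in_arc: "(n ^^ m) x \<in> arc x j \<longleftrightarrow> 0 < m \<and> m \<le> j"
    and E_funpow_in_arc: "E ((n ^^ m) x) \<in> arc x j \<longleftrightarrow> m < j"
proof -
  have "(n ^^ m) x = (n ^^ k) x \<longleftrightarrow> m = k" "E ((n ^^ m) x) = E ((n ^^ k) x) \<longleftrightarrow> m = k"
    if "k \<le> j" for k
    using funpow_eq_iff[OF x, of m k] E_funpow_eq_iff[OF x, of m k] that assms by auto
  then show "(n ^^ m) x \<in> arc x j \<longleftrightarrow> 0 < m \<and> m \<le> j"
    and "E ((n ^^ m) x) \<in> arc x j \<longleftrightarrow> m < j"
    using E_funpow_ne[OF x, of _ m] E_funpow_ne[OF x, of m] unfolding arc_def
    by (auto simp: image_iff) metis+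
qed

text \<open>Locates the other end of the ribbon on the tour. By \<open>twisted_iff\<close>, entering
  it at \<open>D x\<close> rather than at \<open>E (D x)\<close> is what makes the loop
  twisted.\<close>

lemma second_end:
  assumes e: "e \<in> edges B" and x: "x \<in> e"
  obtains j where "0 < j" and "j < period x" and "(n ^^ j) x = D x \<or> (n ^^ j) x = E (D x)"
    and "\<And>m. m < period x \<Longrightarrow> (n ^^ m) x \<in> e \<longleftrightarrow> m = 0 \<or> m = j"
proof -
  have xS: "x \<in> S" using edge_in e x .
  obtain j where j: "j < period x" "(n ^^ j) x = D x \<or> (n ^^ j) x = E (D x)"
    using tour_cases[OF xS D(1)[OF xS]] E(3)[OF funpow_next_in[OF xS]] by metis
  \<comment> \<open>Otherwise two of the four corners of the ribbon would coincide.\<close>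
  have "j \<noteq> 0"
  proof
    assume "j = 0"
    then have "x = D x \<or> x = E (D x)" using j by simp
    then show False using D(2) E_ne_D E(3) D(1) xS by metis
  qed
  moreover have "(n ^^ m) x \<in> e \<longleftrightarrow> m = 0 \<or> m = j" if m: "m < period x" for m
  proof -
    have "e = {x, E x, D x, E (D x)}" using edge_eq[OF e x] .
    also have "\<dots> = {(n ^^ 0) x, E ((n ^^ 0) x), (n ^^ j) x, E ((n ^^ j) x)}"
      using j(2) E(3)[OF D(1)[OF xS]] by auto
    finally have "(n ^^ m) x \<in> e \<longleftrightarrow> (n ^^ m) x = (n ^^ 0) x \<or> (n ^^ m) x = (n ^^ j) x"
      using E_funpow_ne[OF xS, of _ m] by (metis insert_iff singletonD)
    then show ?thesis
      using funpow_eq_iff[OF xS m j(1)] funpow_eq_iff[OF xS m period_pos[OF xS]] by simp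
  qed
  ultimately show thesis using that j by blast
qed

text \<open>The two ends of \<open>e\<close> cut the vertex boundary into two stretches, and the
  indicator of one of them jumps exactly at these ends.\<close>

lemma potential_arc:
  assumes e: "e \<in> edges B" and x: "x \<in> e" and j: "0 < j" "j < period x"
    and mem: "\<And>m. m < period x \<Longrightarrow> (n ^^ m) x \<in> e \<longleftrightarrow> m = 0 \<or> m = j"
  shows "potential e (arc x j)"
  unfolding potential_def
proof (intro conjI ballI)
  have xS: "x \<in> S" using edge_in e x .
  note inS = funpow_next_in[OF xS]
  note arc = arc_iff[OF xS _ j(2)]
  show "arc x j \<subseteq> S"
    using inS E(1) by (auto simp: arc_def)
  fix z assume z: "z \<in> S"
  show "V z \<in> arc x j \<longleftrightarrow> z \<in> arc x j"
  proof (rule tour_cases[OF xS z])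
    fix m assume m: "m < period x" "z = (n ^^ m) x"
    show ?thesis
    proof (cases m)
      \<comment> \<open>The tour wraps around: before index 0 comes index
        \<open>period x - 1\<close>, which is at least \<open>j\<close> and so lies outside the
        arc.\<close>
      case 0
      then have "V z = E ((n ^^ (period x - 1)) x)" using m V_start[OF xS] by simp
      then show ?thesis using arc(1)[of 0] arc(2)[of "period x - 1"] m 0 j by auto
    next
      case (Suc k)
      then have "V z = E ((n ^^ k) x)" using m V_funpow_Suc[OF xS] by simp
      then show ?thesis using arc(1)[of m] arc(2)[of k] m Suc by auto
    qed
  next
    fix m assume m: "m < period x" "z = E ((n ^^ m) x)"
    then have Vz: "V z = (n ^^ Suc m) x" using V_E_funpow by simp
    show ?thesis
    proof (cases "Suc m < period x")
      case True
      then show ?thesis unfolding Vz using arc(1)[of "Suc m"] arc(2)[of m] m by auto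
    next
      case False
      then have "Suc m = period x" using m by simp
      then have "V z = (n ^^ 0) x" using Vz funpow_period[OF xS] by simp
      then show ?thesis
        using arc(1)[of 0] arc(2)[of m] m j period_pos[OF xS] \<open>Suc m = period x\<close> by auto
    qed
  qed
  show "((E z \<in> arc x j) = (z \<in> arc x j)) \<longleftrightarrow> z \<notin> e"
  proof (rule tour_cases[OF xS z])
    fix m assume m: "m < period x" "z = (n ^^ m) x"
    then show ?thesis using arc[of m] mem[of m] j by auto
  next
    fix m assume m: "m < period x" "z = E ((n ^^ m) x)"
    then have "z \<in> e \<longleftrightarrow> (n ^^ m) x \<in> e" "E z = (n ^^ m) x"
      using edge_arcs_in(1)[OF e] inS E(3) by auto
    then show ?thesis using arc[of m] mem[of m] m j by auto
  qed
qed

lemma potential_edge_exists: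
  assumes "e \<in> edges B"
  shows "\<exists>U. potential e U"
  using edge_nonempty[OF assms] second_end[OF assms] potential_arc[OF assms] by (metis ex_in_conv)

text \<open>Interlacing means that the ends of \<open>f\<close> lie on different stretches of the
  boundary cut at the ends of \<open>e\<close>; the indicator of one stretch detects this.\<close>

lemma interlaced_iff:
  assumes e: "e \<in> edges B" and f: "f \<in> edges B" and "e \<noteq> f" and U: "potential e U" and z: "z \<in> f"
  shows "interlaced B e f \<longleftrightarrow> separates U z"
proof
  have disj: "w \<notin> e" if "w \<in> f" for w
    using edge_unique that e f \<open>e \<noteq> f\<close> by blast
  have zS: "z \<in> S" using edge_in f z .
  {
    assume "interlaced B e f"
    then obtain x i k l where x: "x \<in> e" and ikl: "0 < i" "i < k" "k < l"
      and mem: "(n ^^ i) x \<in> f" "(n ^^ k) x \<in> e" "(n ^^ l) x \<in> f"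
      and ne: "\<And>m. 0 < m \<Longrightarrow> m \<le> l \<Longrightarrow> (n ^^ m) x \<noteq> x"
      unfolding interlaced_def by blast
    have xS: "x \<in> S" using edge_in e x .
    have l: "l < period x" using ne[OF period_pos[OF xS]] funpow_period[OF xS] by force
    obtain j where j: "0 < j" "j < period x"
      and je: "\<And>m. m < period x \<Longrightarrow> (n ^^ m) x \<in> e \<longleftrightarrow> m = 0 \<or> m = j"
      using second_end[OF e x] by metis
    \<comment> \<open>The tour stays below one period, so the only later visit to \<open>e\<close>
      is at its second end.\<close>
    have "k = j" using je[of k] mem ikl l by auto
    note arc = potential_arc[OF e x j je]
    let ?w = "(n ^^ i) x" and ?y = "(n ^^ l) x"
    have wS: "?w \<in> S" using funpow_next_in[OF xS] .
    have in_arc: "?w \<in> arc x j" "?y \<notin> arc x j"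
      using funpow_in_arc[OF xS _ j(2)] ikl l \<open>k = j\<close> by auto
    \<comment> \<open>No jump occurs at the ends of \<open>f\<close>, so \<open>?y\<close>, lying
      outside the arc, must belong to the end at \<open>D ?w\<close>.\<close>
    have "E ?w \<in> arc x j" "E (D ?w) \<in> arc x j \<longleftrightarrow> D ?w \<in> arc x j"
      using arc in_arc wS D(1)[OF wS] disj mem(1) edge_arcs_in(2)[OF f wS]
      unfolding potential_def by blast+
    moreover have "?y \<in> {?w, E ?w, D ?w, E (D ?w)}"
      using edge_eq[OF f mem(1)] mem(3) by simp
    ultimately have "D ?w \<notin> arc x j" using in_arc by auto
    then have "separates (arc x j) ?w" using in_arc by (simp add: separates_def)
    then have "separates U ?w" using separates_unique[OF arc U wS] by simp
    then show "separates U z"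
      using separates_edge[of "{e}" U f ?w z] U e f mem(1) z by simp
  next
    assume sep: "separates U z"
    obtain x where x: "x \<in> e" using edge_nonempty[OF e] by blast
    have xS: "x \<in> S" using edge_in e x .
    obtain j where j: "0 < j" "j < period x"
      and je: "\<And>m. m < period x \<Longrightarrow> (n ^^ m) x \<in> e \<longleftrightarrow> m = 0 \<or> m = j"
      using second_end[OF e x] by metis
    note arc = potential_arc[OF e x j je]
    \<comment> \<open>Both corners of an end of \<open>f\<close> have the same value, determined by
      the position of that end relative to \<open>j\<close>.\<close>
    have entry: "\<exists>m < period x. (n ^^ m) x \<in> f \<and> m \<noteq> 0 \<and> m \<noteq> j \<and> (w \<in> arc x j \<longleftrightarrow> m < j)"
      if w: "w \<in> f" for w
    proof (rule tour_cases[OF xS edge_in[OF f w]])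
      fix m assume m: "m < period x" "w = (n ^^ m) x"
      moreover have "m \<noteq> 0" "m \<noteq> j" using je[OF m(1)] disj[OF w] m(2) by auto
      ultimately show ?thesis
        using w funpow_in_arc[OF xS m(1) j(2)] by auto
    next
      fix m assume m: "m < period x" "w = E ((n ^^ m) x)"
      then have f': "(n ^^ m) x \<in> f" using w edge_arcs_in(1)[OF f funpow_next_in[OF xS]] by simp
      moreover have "m \<noteq> 0" "m \<noteq> j" using je[OF m(1)] disj[OF f'] by auto
      ultimately show ?thesis
        using m E_funpow_in_arc[OF xS m(1) j(2)] by auto
    qed
    have "D z \<in> f" using edge_arcs_in(2)[OF f zS] z by simp
    have "separates (arc x j) z" using separates_unique[OF arc U zS] sep by simp
    then obtain w y where "w \<in> f" "y \<in> f" "w \<in> arc x j" "y \<notin> arc x j"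
      using z \<open>D z \<in> f\<close> unfolding separates_def by blast
    then obtain i l where il: "i < j" "i \<noteq> 0" "(n ^^ i) x \<in> f" "l < period x" "l > j" "(n ^^ l) x \<in> f"
      using entry[of w] entry[of y] by (metis nat_neq_iff)
    moreover have "(n ^^ j) x \<in> e" using je[OF j(2)] by simp
    moreover have "0 < i" using il by simp
    moreover have "\<forall>m. 0 < m \<and> m \<le> l \<longrightarrow> (n ^^ m) x \<noteq> x"
      using period_least il(4) by auto
    ultimately show "interlaced B e f"
      using x unfolding interlaced_def by blast
  }
qed

text \<open>The side from \<open>z\<close> reaches the second end either at its entered corner,
  inside the arc, or at its left corner, outside it. Only the latter is compatible with an
  orientation.\<close>

lemma twisted_iff:
  assumes e: "e \<in> edges B" and U: "potential e U" and z: "z \<in> e"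
  shows "twisted B e \<longleftrightarrow> separates U z"
proof -
  have zS: "z \<in> S" using edge_in e z .
  note inS = funpow_next_in[OF zS]
  obtain j where j: "0 < j" "j < period z" and y: "(n ^^ j) z = D z \<or> (n ^^ j) z = E (D z)"
    and je: "\<And>m. m < period z \<Longrightarrow> (n ^^ m) z \<in> e \<longleftrightarrow> m = 0 \<or> m = j"
    using second_end[OF e z] by metis
  note arc = potential_arc[OF e z j je]
  have sep: "separates U z \<longleftrightarrow> separates (arc z j) z"
    using separates_unique[OF arc U zS] .
  have "z \<notin> arc z j" using funpow_in_arc[OF zS period_pos[OF zS] j(2)] by simp
  have j_in: "(n ^^ j) z \<in> arc z j" "E ((n ^^ j) z) \<notin> arc z j"
    using arc_iff[OF zS j(2) j(2)] j by auto
  from y show ?thesis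
  proof
    assume y: "(n ^^ j) z = D z"
    have "separates U z"
      using sep y j_in \<open>z \<notin> arc z j\<close> by (simp add: separates_def)
    moreover have "\<not> orientable_with B e"
    proof
      assume "orientable_with B e"
      then obtain first :: "'c \<Rightarrow> bool" where
        first: "\<And>x. x \<in> S \<Longrightarrow> first (E x) \<noteq> first x \<and> first (V x) \<noteq> first x"
        "\<And>x. x \<in> e \<Longrightarrow> first (D x) \<noteq> first x" unfolding orientable_with_def by blast
      \<comment> \<open>Each tour step crosses one end and one vertex arc, and the two flips
        cancel.\<close>
      have "first ((n ^^ m) z) = first z" for m
      proof (induction m)
        case (Suc m)
        then show ?case
          using first(1)[OF inS[of m]] first(1)[OF E(1)[OF inS[of m]]] V_E_funpow[of m z] by metis
      qed simp
      then show False using first(2)[OF z] y by metis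
    qed
    ultimately show ?thesis by (simp add: twisted_def)
  next
    assume y: "(n ^^ j) z = E (D z)"
    then have Dz: "D z = E ((n ^^ j) z)"
      using E(3) D(1) zS by simp
    have "\<not> separates U z"
      using sep Dz j_in \<open>z \<notin> arc z j\<close> by (simp add: separates_def)
    moreover have "orientable_with B e"
    proof -
      \<comment> \<open>The tour from \<open>z\<close> orients the disc by marking the entered
        corners.\<close>
      define first where "first = (\<lambda>x. x \<in> range (\<lambda>m. (n ^^ m) z))"
      have first: "first ((n ^^ m) z)" "\<not> first (E ((n ^^ m) z))" for m
        using E_funpow_ne[OF zS] by (auto simp: first_def)
      have first_E: "first (E x) \<noteq> first x" if x: "x \<in> S" for x
        by (rule tour_cases[OF zS x]) (use first E(3) inS in auto)
      have first_V: "first (V x) \<noteq> first x" if x: "x \<in> S" for x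
      proof (rule tour_cases[OF zS x])
        fix m assume m: "m < period z" "x = (n ^^ m) z"
        have "\<exists>k. V x = E ((n ^^ k) z)"
          using m V_start[OF zS] V_funpow_Suc[OF zS] by (cases m) auto
        then show ?thesis using m first by auto
      next
        fix m assume m: "m < period z" "x = E ((n ^^ m) z)"
        then show ?thesis using V_E_funpow first by metis
      qed
      have "first (D x) \<noteq> first x" if x: "x \<in> e" for x
      proof -
        have z: "first z" "\<not> first (D z)" using first(1)[of 0] Dz first(2) by auto
        have DS: "D z \<in> S" using edge_arcs_in(2)[OF e zS] assms(3) edge_in[OF e] by blast
        have x: "x \<in> {z, E z, D z, E (D z)}" using edge_eq[OF e assms(3)] x by simp
        have "D (E z) = E (D z)" "D (D z) = z" "D (E (D z)) = E z"
          using E_D[OF zS] E_D[OF DS] D(3) zS by auto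
        then show ?thesis using x z first_E[OF zS] first_E[OF DS] by auto
      qed
      then show ?thesis
        unfolding orientable_with_def using first_E first_V by blast
    qed
    ultimately show ?thesis by (simp add: twisted_def)
  qed
qed

text \<open>Start the tour at the first end of \<open>f\<close> instead; the return to
  \<open>x\<close> after a full period supplies the missing visit to \<open>e\<close>.\<close>

lemma interlaced_sym:
  assumes e: "e \<in> edges B" and "interlaced B e f"
  shows "interlaced B f e"
proof -
  obtain x i k l where x: "x \<in> e" and ikl: "0 < i" "i < k" "k < l"
    and mem: "(n ^^ i) x \<in> f" "(n ^^ k) x \<in> e" "(n ^^ l) x \<in> f"
    and ne: "\<And>m. 0 < m \<Longrightarrow> m \<le> l \<Longrightarrow> (n ^^ m) x \<noteq> x"
    using assms(2) unfolding interlaced_def by blast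
  have xS: "x \<in> S" using edge_in e x .
  have l: "l < period x" using ne[OF period_pos[OF xS]] funpow_period[OF xS] by force
  let ?y = "(n ^^ i) x"
  have shift: "(n ^^ (m - i)) ?y = (n ^^ m) x" if "i \<le> m" for m
    using that by (metis comp_apply funpow_add le_add_diff_inverse2)
  have "(n ^^ (k - i)) ?y \<in> e" "(n ^^ (l - i)) ?y \<in> f" "(n ^^ (period x - i)) ?y \<in> e"
    using shift[of k] shift[of l] shift[of "period x"] ikl l mem x funpow_period[OF xS] by auto
  moreover have "(n ^^ m) ?y \<noteq> ?y" if "0 < m" "m \<le> period x - i" for m
  proof
    assume "(n ^^ m) ?y = ?y"
    then have "(n ^^ (i + m)) x = (n ^^ i) x" by (metis add.commute comp_apply funpow_add)
    then have "(n ^^ m) x = x" by (rule funpow_next_cancel[OF xS])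
    then show False using period_least[of m x] that ikl l by simp
  qed
  moreover have "0 < k - i" "k - i < l - i" "l - i < period x - i" using ikl l by auto
  ultimately show ?thesis
    using mem(1) unfolding interlaced_def by blast
qed

section \<open>Counting boundary components\<close>

text \<open>Links are unordered pairs while interlacing is stated in order, whence the appeal to
  symmetry.\<close>

lemma crosses_iff:
  assumes e: "e \<in> edges B" and g: "g \<in> edges B" and U: "potential g U" and z: "z \<in> e"
  shows "crosses (signed_intersection_graph B) e g \<longleftrightarrow> separates U z"
proof (cases "e = g")
  case True
  then show ?thesis
    using twisted_iff[OF g U] z by (simp add: crosses_def signed_intersection_graph_def)
next
  case False
  then have "{e, g} \<in> links (signed_intersection_graph B) \<longleftrightarrow> interlaced B e g \<or> interlaced B g e"
    using e g by (auto simp: signed_intersection_graph_def doubleton_eq_iff)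
  also have "\<dots> \<longleftrightarrow> interlaced B g e" using interlaced_sym e g by blast
  also have "\<dots> \<longleftrightarrow> separates U z" using interlaced_iff[OF g e _ U z] False by simp
  finally show ?thesis using False by (simp add: crosses_def)
qed

text \<open>Potentials of single edges are added up, and so are the parities of their separations at
  \<open>e\<close>.\<close>

lemma potential_Union_exists:
  assumes "X \<subseteq> edges B"
  shows "\<exists>U. potential (\<Union>X) U \<and> (\<forall>e\<in>edges B. \<forall>z\<in>e.
    separates U z \<longleftrightarrow> odd (card {g \<in> X. crosses (signed_intersection_graph B) e g}))"
  using finite_subset[OF assms finite_edges[OF ribbon_graph]] assms
proof (induction X)
  case empty
  have "potential (\<Union>{}) {}" "\<not> separates {} z" for z by (auto simp: potential_def separates_def)
  then show ?case by auto
next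
  case (insert g X)
  let ?c = "crosses (signed_intersection_graph B)"
  obtain U where U: "potential (\<Union>X) U"
    "\<And>e z. e \<in> edges B \<Longrightarrow> z \<in> e \<Longrightarrow> separates U z \<longleftrightarrow> odd (card {g \<in> X. ?c e g})"
    using insert by auto
  have g: "g \<in> edges B" using insert by simp
  then obtain U' where U': "potential g U'" using potential_edge_exists by blast
  let ?W = "(U - U') \<union> (U' - U)"
  \<comment> \<open>Distinct edges share no corner, so the symmetric difference of the jump sets is
    their union.\<close>
  have "w \<notin> g" if "h \<in> X" "w \<in> h" for h w
    using edge_unique[of h g w] insert.hyps insert.prems that by auto
  then have "(\<Union>X - g) \<union> (g - \<Union>X) = \<Union>(insert g X)" by blast
  then have "potential (\<Union>(insert g X)) ?W" using potential_symdiff[OF U(1) U'] by simp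
  moreover have "separates ?W z \<longleftrightarrow> odd (card {h \<in> insert g X. ?c e h})"
    if e: "e \<in> edges B" and z: "z \<in> e" for e z
  proof -
    have "{h \<in> insert g X. ?c e h} = (if ?c e g then insert g {h \<in> X. ?c e h} else {h \<in> X. ?c e h})"
      by auto
    then have "odd (card {h \<in> insert g X. ?c e h}) \<longleftrightarrow> (odd (card {h \<in> X. ?c e h}) \<longleftrightarrow> \<not> ?c e g)"
      using insert.hyps by simp
    then show ?thesis
      using separates_symdiff U(2)[OF e z] crosses_iff[OF e g U' z] by simp
  qed
  ultimately show ?case by blast
qed

lemma separates_iff_odd:
  assumes X: "X \<subseteq> edges B" and U: "potential (\<Union>X) U" and e: "e \<in> edges B" and z: "z \<in> e"
  shows "separates U z \<longleftrightarrow> odd (card {g \<in> X. crosses (signed_intersection_graph B) e g})"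
  using potential_Union_exists[OF X] separates_unique[OF _ U edge_in[OF e z]] e z by blast

lemma card_potentials:
  assumes "X \<subseteq> edges B"
  shows "card {U. potential (\<Union>X) U} = 2"
proof -
  obtain U where U: "potential (\<Union>X) U" using potential_Union_exists[OF assms] by blast
  then have "{U. potential (\<Union>X) U} = {U, S - U}"
    using potential_unique[OF U] potential_compl by blast
  moreover have "U \<noteq> S - U" using nonempty U unfolding potential_def by blast
  ultimately show ?thesis by simp
qed

lemma potential_determines:
  assumes X: "X \<subseteq> edges B" and Y: "Y \<subseteq> edges B" and "potential (\<Union>X) U" and "potential (\<Union>Y) U"
  shows "X = Y"
proof -
  have "z \<in> \<Union>X \<longleftrightarrow> z \<in> \<Union>Y" if "z \<in> S" for z
    using assms(3,4) that unfolding potential_def by blast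
  then have "\<Union>X = \<Union>Y" using X Y edge_in by blast
  then have "e \<in> X \<longleftrightarrow> e \<in> Y" if e: "e \<in> edges B" for e
  proof -
    obtain z where "z \<in> e" using edge_nonempty[OF e] by blast
    then have "e \<in> W \<longleftrightarrow> z \<in> \<Union>W" if "W \<subseteq> edges B" for W
      using edge_unique[OF e] that by blast
    then show ?thesis using \<open>\<Union>X = \<Union>Y\<close> X Y by metis
  qed
  then show ?thesis using X Y by blast
qed

text \<open>Invariance in the dual means no jump at ends outside \<open>A\<close> and no separation
  on \<open>A\<close>. Sorted by the set of edges where jumps occur, the second condition becomes
  the parity condition.\<close>

lemma invariant_sets_partial_dual:
  assumes A: "A \<subseteq> edges B"
  shows "invariant_sets S (end_arc (partial_dual B A)) V =
    (\<Union>X\<in>even_subsets (signed_intersection_graph B) A. {U. potential (\<Union>X) U})"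
    (is "?I = ?P")
proof
  have inv_iff: "U \<in> ?I \<longleftrightarrow> U \<subseteq> S \<and> (\<forall>z\<in>S. (V z \<in> U \<longleftrightarrow> z \<in> U) \<and>
      (if z \<in> \<Union>A then \<not> separates U z else E z \<in> U \<longleftrightarrow> z \<in> U))" for U
    unfolding invariant_sets_def separates_def partial_dual_def by (auto split: if_splits)
  show "?I \<subseteq> ?P"
  proof
    fix U assume "U \<in> ?I"
    then have sub: "U \<subseteq> S" and inv_V: "\<And>z. z \<in> S \<Longrightarrow> V z \<in> U \<longleftrightarrow> z \<in> U"
      and inv_D: "\<And>z. z \<in> \<Union>A \<Longrightarrow> \<not> separates U z"
      and inv_E: "\<And>z. z \<in> S \<Longrightarrow> z \<notin> \<Union>A \<Longrightarrow> E z \<in> U \<longleftrightarrow> z \<in> U"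
      using edge_in A unfolding inv_iff by (blast, meson, (meson Union_iff subsetD)+)
    define X where "X = {e \<in> A. \<exists>z\<in>e. \<not> (E z \<in> U \<longleftrightarrow> z \<in> U)}"
    have X: "X \<subseteq> A" by (auto simp: X_def)
    \<comment> \<open>As \<open>U\<close> is constant along the sides of \<open>e\<close>, its two
      ends jump together.\<close>
    have jump: "(E z \<in> U \<longleftrightarrow> z \<in> U) \<longleftrightarrow> (E w \<in> U \<longleftrightarrow> w \<in> U)"
      if e: "e \<in> A" and z: "z \<in> e" and w: "w \<in> e" for e z w
    proof -
      have eB: "e \<in> edges B" using e A by blast
      have zS: "z \<in> S" using edge_in[OF eB z] .
      have ins: "E z \<in> e" using edge_arcs_in[OF eB zS] z by simp
      have "D z \<in> U \<longleftrightarrow> z \<in> U" "D (E z) \<in> U \<longleftrightarrow> E z \<in> U"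
        using inv_D e z ins unfolding separates_def by blast+
      moreover have "w \<in> {z, E z, D z, E (D z)}" using edge_eq[OF eB z] w by simp
      moreover have "E (E z) = z" "E (E (D z)) = D z" "D (E z) = E (D z)"
        using E(3)[OF zS] E(3)[OF D(1)[OF zS]] E_D[OF zS] by simp_all
      ultimately show ?thesis by auto
    qed
    have "(E z \<in> U \<longleftrightarrow> z \<in> U) \<longleftrightarrow> z \<notin> \<Union>X" if "z \<in> S" for z
      using jump inv_E[OF that] unfolding X_def by blast
    then have pot: "potential (\<Union>X) U"
      using sub inv_V by (simp add: potential_def)
    have "even (card {g \<in> X. crosses (signed_intersection_graph B) e g})" if e: "e \<in> A" for e
    proof -
      have eB: "e \<in> edges B" using e A by blast
      obtain z where z: "z \<in> e" using edge_nonempty[OF eB] by blast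
      have XB: "X \<subseteq> edges B" using X A by blast
      have "\<not> separates U z" using inv_D e z by blast
      then show ?thesis using separates_iff_odd[OF XB pot eB z] by simp
    qed
    then have "X \<in> even_subsets (signed_intersection_graph B) A"
      using X by (simp add: even_subsets_def)
    then show "U \<in> ?P" using pot by blast
  qed
  show "?P \<subseteq> ?I"
  proof
    fix U assume "U \<in> ?P"
    then obtain X where X: "X \<subseteq> A" and pot: "potential (\<Union>X) U"
      and even: "\<And>e. e \<in> A \<Longrightarrow> even (card {g \<in> X. crosses (signed_intersection_graph B) e g})"
      by (auto simp: even_subsets_def)
    have XB: "X \<subseteq> edges B" using X A by blast
    have "\<not> separates U z" if "z \<in> \<Union>A" for z
      using that separates_iff_odd[OF XB pot] even A by blast
    moreover have "E z \<in> U \<longleftrightarrow> z \<in> U" if "z \<in> S" "z \<notin> \<Union>A" for z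
      using pot that X unfolding potential_def by blast
    ultimately show "U \<in> ?I"
      using pot unfolding inv_iff by (simp add: potential_def)
  qed
qed

text \<open>Each even subset contributes a potential and its complement, and different subsets
  contribute different functions.\<close>

lemma num_vertices_partial_dual_nonempty:
  assumes A: "A \<subseteq> edges B"
  shows "2 ^ num_vertices (partial_dual B A) = 2 * card (even_subsets (signed_intersection_graph B) A)"
proof -
  let ?K = "even_subsets (signed_intersection_graph B) A"
  have "num_vertices (partial_dual B A) = card (curves S (end_arc (partial_dual B A)) V)"
    using isolated by (simp add: num_vertices_def partial_dual_def)
  then have "2 ^ num_vertices (partial_dual B A) = card (invariant_sets S (end_arc (partial_dual B A)) V)"
    using card_invariant_sets[OF matching_on_partial_dual[OF ribbon_graph A]
        ribbon_graphD(4)[OF ribbon_graph] finite_corners] by simp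
  also have "\<dots> = (\<Sum>X\<in>?K. card {U. potential (\<Union>X) U})"
    unfolding invariant_sets_partial_dual[OF A]
  proof (rule card_UN_disjoint)
    have K: "?K \<subseteq> Pow (edges B)" using A by (auto simp: even_subsets_def)
    then show "finite ?K" using finite_subset finite_edges[OF ribbon_graph] by blast
    show "\<forall>X\<in>?K. finite {U. potential (\<Union>X) U}"
    proof
      fix X assume "X \<in> ?K"
      then have "card {U. potential (\<Union>X) U} = 2" using card_potentials K by blast
      then show "finite {U. potential (\<Union>X) U}" by (intro card_ge_0_finite) simp
    qed
    show "\<forall>X\<in>?K. \<forall>Y\<in>?K. X \<noteq> Y \<longrightarrow> {U. potential (\<Union>X) U} \<inter> {U. potential (\<Union>Y) U} = {}"
      using K potential_determines by blast
  qed
  also have "\<dots> = (\<Sum>X\<in>?K. 2)"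
    using A card_potentials by (intro sum.cong) (auto simp: even_subsets_def)
  finally show ?thesis by simp
qed

end

lemma num_vertices_partial_dual:
  assumes B: "bouquet B" and A: "A \<subseteq> edges B"
  shows "2 ^ num_vertices (partial_dual B A) = 2 * card (even_subsets (signed_intersection_graph B) A)"
proof (cases "corners B = {}")
  \<comment> \<open>The edgeless bouquet has one vertex and the empty set as its only even subset,
    so both sides equal 2.\<close>
  case True
  then have "edges B = {}" by (simp add: edges_def curves_def)
  then have "even_subsets (signed_intersection_graph B) A = {{}}"
    using A by (auto simp: even_subsets_def)
  moreover have "num_vertices (partial_dual B A) = 1"
    using B True by (simp add: bouquet_def num_vertices_def partial_dual_def curves_def)
  ultimately show ?thesis by simp
next
  case False
  then interpret nonempty_bouquet B using B by unfold_locales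
  show ?thesis by (rule num_vertices_partial_dual_nonempty[OF A])
qed

text \<open>Reduces the comparison of genera to vertex counts at a set and at its
  complement.\<close>

lemma euler_genus_partial_dual:
  assumes "ribbon_graph G" and "A \<subseteq> edges G"
  shows "euler_genus (partial_dual G A) = 2 + int (card (edges G)) -
    int (num_vertices (partial_dual G A)) - int (num_vertices (partial_dual G (edges G - A)))"
  unfolding euler_genus_def num_edges_partial_dual num_boundary_partial_dual[OF assms]
  by (simp add: num_edges_def)

theorem theorem9:
  fixes B1 :: "'a ribbon_graph" and B2 :: "'b ribbon_graph"
  assumes "bouquet B1" and "bouquet B2"
    and "signed_graph_iso (signed_intersection_graph B1) (signed_intersection_graph B2)"
  shows "partial_dual_genus_poly B1 = partial_dual_genus_poly B2"
proof -
  let ?H = "signed_intersection_graph B1" and ?K = "signed_intersection_graph B2"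
  have nodes: "nodes ?H = edges B1" "nodes ?K = edges B2"
    by (simp_all add: signed_intersection_graph_def)
  have G: "ribbon_graph B1" "ribbon_graph B2" using assms by (auto simp: bouquet_def)
  obtain \<phi> where bij: "bij_betw \<phi> (edges B1) (edges B2)"
    and links: "\<And>u v. u \<in> nodes ?H \<Longrightarrow> v \<in> nodes ?H \<Longrightarrow> {u, v} \<in> links ?H \<longleftrightarrow> {\<phi> u, \<phi> v} \<in> links ?K"
    and sign: "\<And>u. u \<in> nodes ?H \<Longrightarrow> sign_of ?K (\<phi> u) = sign_of ?H u"
    using assms(3) unfolding signed_graph_iso_def nodes by blast
  have vertices: "num_vertices (partial_dual B2 (\<phi> ` A)) = num_vertices (partial_dual B1 A)"
    if A: "A \<subseteq> edges B1" for A
  proof -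
    have "\<phi> ` A \<subseteq> edges B2" using bij A by (auto simp: bij_betw_def)
    then have "(2::nat) ^ num_vertices (partial_dual B2 (\<phi> ` A)) = 2 ^ num_vertices (partial_dual B1 A)"
      using num_vertices_partial_dual[OF assms(1) A] num_vertices_partial_dual[OF assms(2)]
        card_even_subsets_image[of \<phi> ?H ?K A, OF _ links sign] bij nodes A by simp
    then show ?thesis by (simp add: power_inject_exp)
  qed
  have genus: "euler_genus (partial_dual B2 (\<phi> ` A)) = euler_genus (partial_dual B1 A)"
    if A: "A \<in> Pow (edges B1)" for A
  proof -
    \<comment> \<open>The bijection respects complements, so \<open>vertices\<close> applies to both
      vertex counts in the genus formula.\<close>
    have "edges B2 - \<phi> ` A = \<phi> ` (edges B1 - A)"
      using bij A inj_on_image_set_diff[of \<phi> "edges B1" "edges B1" A] by (auto simp: bij_betw_def)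
    moreover have "\<phi> ` A \<subseteq> edges B2" using bij A by (auto simp: bij_betw_def)
    ultimately show ?thesis
      using A G vertices[of A] vertices[of "edges B1 - A"] bij_betw_same_card[OF bij]
      by (simp add: euler_genus_partial_dual)
  qed
  have "partial_dual_genus_poly B2 =
      (\<Sum>A\<in>Pow (edges B1). monom 1 (nat (euler_genus (partial_dual B2 (\<phi> ` A)))))"
    unfolding partial_dual_genus_poly_def
    by (rule sum.reindex_bij_betw[OF bij_betw_Pow[OF bij], symmetric])
  then show ?thesis
    unfolding partial_dual_genus_poly_def using genus by simp
qed

end
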